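(* Consider the nonlinear system $$\dot x=f(x)+Bu+Ed,\qquad y=h(x),\qquad e=y-r,$$ with $x\in\mathbb R^n$, $u\in\mathbb R^m$, constant disturbance $d\in\mathbb R^q$, constant reference $r\in\mathbb R^p$, $y,e\in\mathbb R^p$. Assume $f(x)=AZ(x)$ and $h(x)=CZ(x)$ for some $A\in\mathbb R^{n\times s}$, $C\in\mathbb R^{p\times s}$, with $Z:\mathbb R^n\to\mathbb R^s$ continuously differentiable of the form $Z(x)=\begin{bmatrix} x \\ Q(x) \end{bmatrix}$, $Q:\mathbb R^n\to\mathbb R^{s-n}$ containing only nonlinear functions, and let $$\mathcal Z(x,\xi)=\begin{bmatrix} x \\ \xi \\ Q(x) \end{bmatrix},\qquad \xi\in\mathbb R^p.$$ Let $\mathcal A,\mathcal B$ be the matrices of the system extended with the integral action $\dot\xi=e$, and let $U_0,\mathcal Z_0,\mathcal Z_1$ be the data matrices, as defined in the context. Let $R_Q\in\mathbb R^{n\times\tau}$ be a matrix and $\mathcal X\subseteq\mathbb R^n$ a set such that $\frac{\partial Q}{\partial x}(x)^\top\frac{\partial Q}{\partial x}(x)\preceq R_QR_Q^\top$ for any $x\in\mathcal X$, and set $\mathcal R_Q:=\begin{bmatrix} R_Q \\ 0_{p\times\tau} \end{bmatrix}$. Consider the following semidefinite program in the decision variables $\mathcal P\in\mathbb S^{(n+p)\times(n+p)}$, $\mathcal Y_1\in\mathbb R^{T\times(n+p)}$, $\mathcal G_2\in\mathbb R^{T\times(s-n)}$, $\alpha\in\mathbb R_{>0}$: $$\mathcal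 P\succ0,\qquad \mathcal Z_0\mathcal Y_1=\begin{bmatrix} \mathcal P \\ 0_{(s-n)\times(n+p)} \end{bmatrix},$$ $$\begin{bmatrix} \mathcal Z_1\mathcal Y_1+(\mathcal Z_1\mathcal Y_1)^\top+\alpha I_{n+p} & \star & \star \\ \mathcal G_2^\top\mathcal Z_1^\top & -I_{s-n} & \star \\ \mathcal R_Q^\top\mathcal P & 0 & -I_\tau \end{bmatrix}\preceq0,$$ $$\mathcal Z_0\mathcal G_2=\begin{bmatrix} 0_{(n+p)\times(s-n)} \\ I_{s-n} \end{bmatrix},\qquad \mathbb 1_{1\times T}\begin{bmatrix} \mathcal Y_1 & \mathcal G_2 \end{bmatrix}=0_{1\times(s+p)}.$$ If the program is feasible, then the control law $u=\mathcal K\mathcal Z(x,\xi)$ with $\mathcal K=U_0\begin{bmatrix} \mathcal Y_1\mathcal P^{-1} & \mathcal G_2 \end{bmatrix}$ is such that the closed-loop dynamics $\dot x=f(x)+B\mathcal K\mathcal Z(x,\xi)+Ed$, $\dot\xi=h(x)-r$ are exponentially contractive on $\mathcal X\times\mathbb R^p$, i.e., there exists $\beta>0$ such that for all $(x,\xi)\in\mathcal X\times\mathbb R^p$ $$\Big[(\mathcal A+\mathcal B\mathcal K)\frac{\partial\mathcal Z(x,\xi)}{\partial(x,\xi)}\Big]^\top\mathcal P^{-1}+\mathcal P^{-1}\Big[(\mathcal A+\mathcal B\mathcal K)\frac{\partial\mathcal Z(x,\xi)}{\partial(x,\xi)}\Big]\preceq-\beta\mathcal P^{-1}.$$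
   Context: $\mathbb S^{k\times k}$ is the set of real symmetric $k\times k$ matrices; $\succ,\succeq,\prec,\preceq$ refer to (semi)definiteness; $\star$ denotes entries determined by symmetry; $\mathbb 1_{1\times T}$ is the $1\times T$ matrix of all ones. Throughout, $d$ and $r$ are constant, and $A,B,C,d$ are unknown to the designer. Partition $A=[\overline A\ \ \hat A]$, $C=[\overline C\ \ \hat C]$ with $\overline A\in\mathbb R^{n\times n}$, $\overline C\in\mathbb R^{p\times n}$. The system extended with $\dot\xi=e$ reads $\begin{bmatrix} \dot x \\ \dot\xi \end{bmatrix}=\mathcal A\mathcal Z(x,\xi)+\mathcal Bu+\mathcal Ed-\mathcal Ir$, where $$\mathcal A=\begin{bmatrix} \overline A & 0_{n\times p} & \hat A \\ \overline C & 0_{p\times p} & \hat C \end{bmatrix},\quad \mathcal B=\begin{bmatrix} B \\ 0_{p\times m} \end{bmatrix},\quad \mathcal E=\begin{bmatrix} E \\ 0_{p\times q} \end{bmatrix},\quad \mathcal I=\begin{bmatrix} 0_{n\times p} \\ I_p \end{bmatrix}.$$ Data: for an integer $T>0$ and distinct sampling times $t_0<\dots<t_{T-1}$, samples of $x,u,y,\dot x,\xi$ along a trajectory of the extended system (with the constant disturbance $d$) are collected in $U_0=[u(t_0)\ \cdots\ u(t_{T-1})]$, $$\mathcal Z_1=\begin{bmatrix} \dot x(t_0) & \cdots & \dot x(t_{T-1}) \\ y(t_0) & \cdots & y(t_{T-1}) \end{bmatrix},\qquad \mathcal Z_0=\begin{bmatrix} x(t_0) & \cdots & x(t_{T-1})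 \\ \xi(t_0) & \cdots & \xi(t_{T-1}) \\ Q(x(t_0)) & \cdots & Q(x(t_{T-1})) \end{bmatrix}.$$ They satisfy $\mathcal Z_1=\mathcal A\mathcal Z_0+\mathcal BU_0+\mathcal ED_0$ with $D_0=d\,\mathbb 1_{1\times T}$. *)

theory Defs
  imports "HOL-Analysis.Analysis"
begin

text \<open>
  Block vectors and matrices are indexed by sum types, \<open>Inl\<close> indices coming first. Since a matrix is
  a vector of rows, \<open>vstack\<close> stacks both vectors and matrices.
\<close>

definition vstack :: "'c ^ 'a \<Rightarrow> 'c ^ 'b \<Rightarrow> 'c ^ ('a::finite + 'b::finite)" where
  "vstack v w = (\<chi> i. case i of Inl a \<Rightarrow> v $ a | Inr b \<Rightarrow> w $ b)"

definition hstack :: "'c ^ 'a ^ 'r \<Rightarrow> 'c ^ 'b ^ 'r \<Rightarrow> 'c ^ ('a::finite + 'b::finite) ^ 'r" where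
  "hstack M N = (\<chi> i. vstack (M $ i) (N $ i))"

definition upper :: "'c ^ ('a::finite + 'b::finite) \<Rightarrow> 'c ^ 'a" where
  "upper v = (\<chi> i. v $ Inl i)"

definition lower :: "'c ^ ('a::finite + 'b::finite) \<Rightarrow> 'c ^ 'b" where
  "lower v = (\<chi> i. v $ Inr i)"

definition col_matrix :: "('t \<Rightarrow> 'c ^ 'r) \<Rightarrow> 'c ^ 't ^ 'r" where
  "col_matrix v = (\<chi> i j. v j $ i)"

definition ones_row :: "real ^ 't ^ 1" where
  "ones_row = (\<chi> i j. 1)"

text \<open>Definiteness is that of symmetric matrices; symmetry is part of the predicates.\<close>

definition pos_semidef :: "real ^ 'a ^ 'a \<Rightarrow> bool" where
  "pos_semidef M \<longleftrightarrow> transpose M = M \<and> (\<forall>v. 0 \<le> v \<bullet> (M *v v))"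

definition pos_def :: "real ^ 'a ^ 'a \<Rightarrow> bool" where
  "pos_def M \<longleftrightarrow> transpose M = M \<and> (\<forall>v. v \<noteq> 0 \<longrightarrow> 0 < v \<bullet> (M *v v))"

definition loewner_le :: "real ^ 'a ^ 'a \<Rightarrow> real ^ 'a ^ 'a \<Rightarrow> bool" (infix "\<preceq>" 50) where
  "M \<preceq> N \<longleftrightarrow> pos_semidef (N - M)"

definition continuously_differentiable :: "(real ^ 'a \<Rightarrow> real ^ 'b) \<Rightarrow> bool" where
  "continuously_differentiable g \<longleftrightarrow>
     (\<forall>x. g differentiable (at x)) \<and> continuous_on UNIV (\<lambda>x. jacobian g (at x))"

definition ext_Z ::
  "(real ^ 'n \<Rightarrow> real ^ 'k) \<Rightarrow> real ^ ('n::finite + 'p::finite) \<Rightarrow> real ^ (('n::finite + 'p::finite) + 'k::finite)" where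
  "ext_Z Q z = vstack (vstack (upper z) (lower z)) (Q (upper z))"

definition ext_A ::
  "real ^ 'n ^ 'n \<Rightarrow> real ^ 'k ^ 'n \<Rightarrow> real ^ 'n ^ 'p \<Rightarrow> real ^ 'k ^ 'p
    \<Rightarrow> real ^ (('n::finite + 'p::finite) + 'k::finite) ^ ('n::finite + 'p::finite)" where
  "ext_A Abar Ahat Cbar Chat =
     vstack (hstack (hstack Abar 0) Ahat)
            (hstack (hstack Cbar 0) Chat)"

definition ext_B :: "real ^ 'm ^ 'n \<Rightarrow> real ^ 'm ^ ('n::finite + 'p::finite)" where
  "ext_B B = vstack B 0"

text \<open>
  A trajectory on \<open>J\<close> of the system with integral action. The states are continuous and the
  differential equations hold off the set \<open>N\<close>, which is to contain the finitely many instants at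
  which a piecewise continuous input switches; \<open>N = {}\<close> gives the classical solutions. The function
  \<open>xdot\<close> is the derivative of \<open>x\<close>.
\<close>

definition ext_trajectory ::
  "(real ^ 'n \<Rightarrow> real ^ 'n) \<Rightarrow> (real ^ 'n \<Rightarrow> real ^ 'p) \<Rightarrow> real ^ 'm ^ 'n \<Rightarrow> real ^ 'q ^ 'n
    \<Rightarrow> real ^ 'q \<Rightarrow> real ^ 'p \<Rightarrow> real set \<Rightarrow> real set
    \<Rightarrow> (real \<Rightarrow> real ^ 'n) \<Rightarrow> (real \<Rightarrow> real ^ 'n) \<Rightarrow> (real \<Rightarrow> real ^ 'm)
    \<Rightarrow> (real \<Rightarrow> real ^ 'p) \<Rightarrow> (real \<Rightarrow> real ^ 'p) \<Rightarrow> (real \<Rightarrow> real ^ 'p) \<Rightarrow> bool" where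
  "ext_trajectory f h B E d r J N x xdot u y e \<xi> \<longleftrightarrow>
     finite N \<and> continuous_on J x \<and> continuous_on J \<xi> \<and>
     (\<forall>t\<in>J. y t = h (x t) \<and> e t = y t - r) \<and>
     (\<forall>t\<in>J - N. (x has_vector_derivative xdot t) (at t within J) \<and>
                xdot t = f (x t) + B *v u t + E *v d \<and>
                (\<xi> has_vector_derivative e t) (at t within J))"

text \<open>The constraints of the semidefinite program; \<open>\<R>\<close> is the zero-padded bound.\<close>

definition sdp_feasible ::
  "real ^ 't ^ (('n::finite + 'p::finite) + 'k::finite) \<Rightarrow> real ^ 't ^ ('n::finite + 'p::finite) \<Rightarrow> real ^ '\<tau> ^ ('n::finite + 'p::finite)
    \<Rightarrow> real ^ ('n::finite + 'p::finite) ^ ('n::finite + 'p::finite) \<Rightarrow> real ^ ('n::finite + 'p::finite) ^ 't \<Rightarrow> real ^ 'k ^ 't \<Rightarrow> real \<Rightarrow> bool" where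
  "sdp_feasible Z0 Z1 \<R> P Y1 G2 \<alpha> \<longleftrightarrow>
     \<alpha> > 0 \<and>
     pos_def P \<and>
     Z0 ** Y1 = vstack P 0 \<and>
     vstack
       (vstack
         (hstack (hstack (Z1 ** Y1 + transpose (Z1 ** Y1) + \<alpha> *\<^sub>R mat 1)
                         (transpose (transpose G2 ** transpose Z1)))
                 (transpose (transpose \<R> ** P)))
         (hstack (hstack (transpose G2 ** transpose Z1) (- mat 1)) 0))
       (hstack (hstack (transpose \<R> ** P) 0) (- mat 1))
     \<preceq> 0 \<and>
     Z0 ** G2 = vstack 0 (mat 1) \<and>
     ones_row ** hstack Y1 G2 = 0"

definition closed_loop ::
  "(real ^ 'n \<Rightarrow> real ^ 'n) \<Rightarrow> (real ^ 'n \<Rightarrow> real ^ 'p) \<Rightarrow> real ^ 'm ^ 'n \<Rightarrow> real ^ 'q ^ 'n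
    \<Rightarrow> real ^ 'q \<Rightarrow> real ^ 'p \<Rightarrow> (real ^ 'n \<Rightarrow> real ^ 'k) \<Rightarrow> real ^ (('n::finite + 'p::finite) + 'k::finite) ^ 'm
    \<Rightarrow> real ^ ('n::finite + 'p::finite) \<Rightarrow> real ^ ('n::finite + 'p::finite)" where
  "closed_loop f h B E d r Q K z =
     vstack (f (upper z) + B *v (K *v ext_Z Q z) + E *v d) (h (upper z) - r)"

definition exp_contractive ::
  "(real ^ 'a \<Rightarrow> real ^ 'a) \<Rightarrow> real ^ 'a ^ 'a \<Rightarrow> (real ^ 'a) set \<Rightarrow> bool" where
  "exp_contractive F M S \<longleftrightarrow>
     (\<forall>z\<in>S. F differentiable (at z)) \<and> pos_def M \<and>
     (\<exists>\<beta>>0. \<forall>z\<in>S. transpose (jacobian F (at z)) ** M + M ** jacobian F (at z) \<preceq> (- \<beta>) *\<^sub>R M)"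

end

theory Submission
  imports Defs
begin

text \<open>
  Put \<open>W = [Y1 P\<^sup>-\<^sup>1, G2]\<close>. The constraints give \<open>Z0 W = 1\<close> and annihilate the disturbance
  term of the data, so that \<open>\<A> + \<B> K = (\<A> Z0 + \<B> U0) W = Z1 W\<close>. With \<open>J = \<partial>Q/\<partial>x [1 0]\<close> the
  closed-loop Jacobian is therefore \<open>Z1 Y1 P\<^sup>-\<^sup>1 + Z1 G2 J\<close>. Evaluating the quadratic form of the
  matrix inequality at \<open>(a, J P a, \<R>\<^sup>T P a)\<close> and using \<open>|J P a| \<le> |\<R>\<^sup>T P a|\<close> bounds
  \<open>2 a \<bullet> (Z1 Y1 + Z1 G2 J P) a\<close> by \<open>- \<alpha> |a|\<^sup>2\<close>; the substitution \<open>a = P\<^sup>-\<^sup>1 v\<close> is the claim.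
\<close>

text \<open>Products with a transpose stay in the form \<open>transpose M *v v\<close>, so that they
  can be moved across inner products.\<close>

declare transpose_matrix_vector [simp del]

section \<open>Algebra of block vectors and matrices\<close>

lemma upper_vstack [simp]: "upper (vstack v w) = v"
  by (simp add: upper_def vstack_def vec_eq_iff)

lemma lower_vstack [simp]: "lower (vstack v w) = w"
  by (simp add: lower_def vstack_def vec_eq_iff)

lemma vstack_upper_lower [simp]: "vstack (upper v) (lower v) = v"
  by (simp add: upper_def lower_def vstack_def vec_eq_iff split: sum.split)

lemma vstack_eq_iff: "v = w \<longleftrightarrow> upper v = upper w \<and> lower v = lower w"
  by (metis vstack_upper_lower)

lemma upper_add [simp]: "upper (v + w) = upper v + upper w"
  and lower_add [simp]: "lower (v + w) = lower v + lower w"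
  and upper_scaleR [simp]: "upper (c *\<^sub>R s) = c *\<^sub>R upper s"
  and lower_scaleR [simp]: "lower (c *\<^sub>R s) = c *\<^sub>R lower s"
  and upper_zero [simp]: "upper 0 = 0"
  and lower_zero [simp]: "lower 0 = 0"
  by (simp_all add: upper_def lower_def vec_eq_iff)

lemma vstack_mult_vec [simp]: "vstack M N *v v = vstack (M *v v) (N *v v)"
  by (simp add: vstack_def matrix_vector_mult_def vec_eq_iff split: sum.split)

lemma hstack_mult_vec [simp]:
  fixes M :: "real ^ 'a::finite ^ 'r"
  shows "hstack M N *v v = M *v upper v + N *v lower v"
  \<comment> \<open>The index type is read as a disjoint sum so that \<open>sum.Plus\<close> splits
    the row sum; the default rewriting goes the opposite way.\<close>
  by (simp add: hstack_def vstack_def upper_def lower_def matrix_vector_mult_def vec_eq_iff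
      UNIV_Plus_UNIV [symmetric] sum.Plus del: UNIV_Plus_UNIV)

lemma inner_vstack [simp]:
  fixes a c :: "real ^ 'a::finite" and b d :: "real ^ 'b::finite"
  shows "vstack a b \<bullet> vstack c d = a \<bullet> c + b \<bullet> d"
  by (simp add: inner_vec_def vstack_def UNIV_Plus_UNIV [symmetric] sum.Plus del: UNIV_Plus_UNIV)

lemma vstack_decompose: "vstack v w = vstack v 0 + vstack 0 (w :: real ^ _)"
  by (simp add: vstack_eq_iff)

section \<open>Derivatives of stacked maps\<close>

lemma bounded_linear_upper: "bounded_linear (upper :: real ^ ('a::finite + 'b::finite) \<Rightarrow> _)"
  and bounded_linear_lower: "bounded_linear (lower :: real ^ ('a::finite + 'b::finite) \<Rightarrow> _)"
  by (auto intro!: linearI simp: linear_conv_bounded_linear [symmetric])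

text \<open>Stacking is the sum of two bounded linear embeddings, so the chain and sum rules
  apply.\<close>

lemma has_derivative_vstack:
  fixes F :: "'x::real_normed_vector \<Rightarrow> real ^ 'a::finite" and G :: "'x \<Rightarrow> real ^ 'b::finite"
  assumes "(F has_derivative F') net" and "(G has_derivative G') net"
  shows "((\<lambda>x. vstack (F x) (G x)) has_derivative (\<lambda>v. vstack (F' v) (G' v))) net"
proof -
  have "bounded_linear (\<lambda>v :: real ^ 'a. vstack v (0 :: real ^ 'b))"
    "bounded_linear (\<lambda>w :: real ^ 'b. vstack (0 :: real ^ 'a) w)"
    by (auto intro!: linearI simp: linear_conv_bounded_linear [symmetric] vstack_eq_iff)
  from has_derivative_add [OF bounded_linear.has_derivative [OF this(1) assms(1)]
      bounded_linear.has_derivative [OF this(2) assms(2)]]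
  show ?thesis
    by (simp add: vstack_decompose [symmetric])
qed

lemma jacobian_eqI:
  fixes F :: "real ^ 'a::finite \<Rightarrow> real ^ 'b::finite"
  assumes "(F has_derivative (*v) M) (at z)"
  shows "jacobian F (at z) = M"
  unfolding jacobian_def frechet_derivative_at [OF assms, symmetric]
  by (rule matrix_of_matrix_vector_mul)

lemma ext_Z_eq: "ext_Z Q z = vstack z (Q (upper z))"
  by (simp add: ext_Z_def)

text \<open>Up to regrouping, \<open>ext_Z Q\<close> is the identity stacked on \<open>Q\<close> of
  the upper part. This gives the identity block, and zero columns for the integrator state in the
  rows below.\<close>

lemma ext_Z_has_derivative:
  fixes Q :: "real ^ 'n::finite \<Rightarrow> real ^ 'k::finite" and z :: "real ^ ('n + 'p::finite)"
  assumes "Q differentiable (at (upper z))"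
  shows "(ext_Z Q has_derivative
    (*v) (vstack (mat 1) (hstack (jacobian Q (at (upper z))) 0))) (at z)"
proof -
  have Q: "((\<lambda>z. Q (upper z)) has_derivative (\<lambda>v. jacobian Q (at (upper z)) *v upper v)) (at z)"
    by (rule has_derivative_compose
        [OF bounded_linear_imp_has_derivative [OF bounded_linear_upper]
          assms [unfolded jacobian_works]])
  have "(\<lambda>v. vstack v (jacobian Q (at (upper z)) *v upper v))
      = (*v) (vstack (mat 1) (hstack (jacobian Q (at (upper z))) 0) :: real ^ ('n + 'p) ^ (('n + 'p) + 'k))"
    by (rule ext) simp
  then show ?thesis
    using has_derivative_vstack [OF has_derivative_ident Q] by (simp add: ext_Z_eq [abs_def] del: vstack_mult_vec)
qed

section \<open>Data matrices and transposes\<close>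

lemma col_matrix_mult_vec:
  fixes v :: "'t::finite \<Rightarrow> real ^ 'r"
  shows "col_matrix v *v w = (\<Sum>j\<in>UNIV. w $ j *\<^sub>R v j)"
  by (simp add: col_matrix_def matrix_vector_mult_def vec_eq_iff mult.commute)

lemma matrix_mult_col_matrix:
  fixes M :: "real ^ 'r::finite ^ 's"
  shows "M ** col_matrix v = col_matrix (\<lambda>j. M *v v j)"
  by (simp add: col_matrix_def matrix_matrix_mult_def matrix_vector_mult_def)

lemma uminus_mult_vec: "(- M) *v v = - (M *v v)" for M :: "real ^ 'a::finite ^ 'b"
  by (simp add: matrix_vector_mult_def vec_eq_iff sum_negf)

lemma transpose_add: "transpose (M + N) = transpose M + transpose (N :: real ^ _ ^ _)"
  and transpose_diff: "transpose (M - N) = transpose M - transpose (N :: real ^ _ ^ _)"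
  by (simp_all add: transpose_def vec_eq_iff)

lemma inner_transpose_mult_vec:
  fixes M :: "real ^ 'a::finite ^ 'b::finite"
  shows "v \<bullet> (transpose M *v w) = (M *v v) \<bullet> w"
  by (metis dot_lmul_matrix inner_commute transpose_matrix_vector)

section \<open>Positive definite matrices and the Loewner order\<close>

lemma pos_def_invertible:
  fixes P :: "real ^ 'a::finite ^ 'a"
  assumes "pos_def P"
  shows "invertible P"
proof -
  have "v = 0" if "P *v v = 0" for v
    using assms that unfolding pos_def_def by (metis inner_zero_right less_irrefl)
  then show ?thesis
    by (metis invertible_left_inverse matrix_left_invertible_ker)
qed

lemma matrix_inv_mult:
  fixes P :: "real ^ 'a::finite ^ 'a"
  assumes "invertible P"
  shows "P ** matrix_inv P = mat 1" "matrix_inv P ** P = mat 1"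
  using assms unfolding invertible_def matrix_inv_def
  by (metis (mono_tags, lifting) someI_ex)+

lemma matrix_inv_mult_vec:
  fixes P :: "real ^ 'a::finite ^ 'a"
  assumes "invertible P"
  shows "P *v (matrix_inv P *v v) = v" "matrix_inv P *v (P *v v) = v"
  using matrix_inv_mult [OF assms] by (simp_all add: matrix_vector_mul_assoc)

text \<open>Symmetry follows by inserting \<open>P ** matrix_inv P\<close> and transposing,
  positivity by evaluating the form of \<open>P\<close> at \<open>matrix_inv P *v v\<close>.\<close>

lemma pos_def_matrix_inv:
  fixes P :: "real ^ 'a::finite ^ 'a"
  assumes "pos_def P"
  shows "pos_def (matrix_inv P)"
proof -
  note inv = pos_def_invertible [OF assms]
  have sym: "transpose P = P" using assms by (simp add: pos_def_def)
  have "transpose (matrix_inv P) = transpose (matrix_inv P) ** (P ** matrix_inv P)"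
    by (simp add: matrix_inv_mult [OF inv])
  also have "\<dots> = transpose (P ** matrix_inv P) ** matrix_inv P"
    by (simp add: matrix_transpose_mul matrix_mul_assoc sym)
  also have "\<dots> = matrix_inv P"
    by (simp add: matrix_inv_mult [OF inv])
  finally have "transpose (matrix_inv P) = matrix_inv P" .
  moreover have "0 < v \<bullet> (matrix_inv P *v v)" if "v \<noteq> 0" for v
  proof -
    have "matrix_inv P *v v \<noteq> 0"
      using that matrix_inv_mult_vec [OF inv] by (metis matrix_vector_mult_0_right)
    then have "0 < (matrix_inv P *v v) \<bullet> (P *v (matrix_inv P *v v))"
      using assms by (simp add: pos_def_def)
    then show ?thesis by (simp add: matrix_inv_mult_vec [OF inv] inner_commute)
  qed
  ultimately show ?thesis by (simp add: pos_def_def)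
qed

text \<open>Cauchy-Schwarz, together with \<open>v = P *v (matrix_inv P *v v)\<close> and the
  operator norm of \<open>P\<close>. This turns decay in the Euclidean norm into decay in the metric
  \<open>matrix_inv P\<close>.\<close>

lemma pos_def_inner_matrix_inv_le:
  fixes P :: "real ^ 'a::finite ^ 'a"
  assumes "pos_def P"
  shows "v \<bullet> (matrix_inv P *v v) \<le> onorm ((*v) P) * (norm (matrix_inv P *v v))\<^sup>2"
proof -
  let ?a = "matrix_inv P *v v"
  have "norm v \<le> onorm ((*v) P) * norm ?a"
    using onorm [OF matrix_vector_mul_bounded_linear, of P ?a]
    by (simp add: matrix_inv_mult_vec [OF pos_def_invertible [OF assms]])
  then have "norm v * norm ?a \<le> onorm ((*v) P) * norm ?a * norm ?a"
    by (rule mult_right_mono) simp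
  then show ?thesis
    using norm_cauchy_schwarz [of v ?a] by (simp add: power2_eq_square mult.assoc)
qed

text \<open>By symmetry of \<open>M\<close> both summands on the left contribute the same scalar
  \<open>(M *v v) \<bullet> (V *v v)\<close>, hence the factor 2.\<close>

lemma contraction_from_quadratic_form:
  fixes V M :: "real ^ 'a::finite ^ 'a"
  assumes sym: "transpose M = M"
    and le: "\<And>v. 2 * ((M *v v) \<bullet> (V *v v)) \<le> - \<beta> * (v \<bullet> (M *v v))"
  shows "transpose V ** M + M ** V \<preceq> (- \<beta>) *\<^sub>R M"
proof -
  have "v \<bullet> (((- \<beta>) *\<^sub>R M - (transpose V ** M + M ** V)) *v v)
      = - \<beta> * (v \<bullet> (M *v v)) - 2 * ((M *v v) \<bullet> (V *v v))" for v
  proof -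
    have "v \<bullet> (M *v (V *v v)) = (M *v v) \<bullet> (V *v v)"
      using inner_transpose_mult_vec [of v M] sym by simp
    moreover have "v \<bullet> (transpose V *v (M *v v)) = (M *v v) \<bullet> (V *v v)"
      by (simp add: inner_transpose_mult_vec inner_commute)
    ultimately show ?thesis
      by (simp add: matrix_vector_mult_diff_rdistrib matrix_vector_mult_add_rdistrib uminus_mult_vec
          matrix_vector_mul_assoc [symmetric] scaleR_matrix_vector_assoc [symmetric] inner_simps)
  qed
  moreover have "transpose ((- \<beta>) *\<^sub>R M - (transpose V ** M + M ** V))
      = (- \<beta>) *\<^sub>R M - (transpose V ** M + M ** V)"
    by (simp only: transpose_add transpose_diff transpose_scalar matrix_transpose_mul
        transpose_transpose sym add.commute)
  ultimately show ?thesis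
    using le by (simp add: loewner_le_def pos_semidef_def)
qed

text \<open>A Schur complement argument carried out on vectors. \<open>G\<close> stands for the
  Jacobian of \<open>Q\<close> at a point of the region, and the left side becomes the closed-loop
  Jacobian once \<open>a\<close> is replaced by \<open>matrix_inv P *v v\<close>.\<close>

lemma sdp_feasible_quadratic_form:
  fixes Z0 :: "real ^ 't::finite ^ (('n::finite + 'p::finite) + 'k::finite)"
    and G :: "real ^ 'n ^ 'k" and R :: "real ^ '\<tau>::finite ^ 'n"
  assumes feasible: "sdp_feasible Z0 Z1 (vstack R 0) P Y1 G2 \<alpha>"
    and G: "transpose G ** G \<preceq> R ** transpose R"
  shows "2 * (a \<bullet> (Z1 *v (Y1 *v a + G2 *v (G *v upper (P *v a))))) \<le> - \<alpha> * (norm a)\<^sup>2"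
proof -
  let ?w = "upper (P *v a)"
  \<comment> \<open>The zero padding makes the transposed bound see only the upper part of its
    argument. The identity is checked by testing against all vectors.\<close>
  have RT: "transpose (vstack R (0 :: real ^ '\<tau> ^ 'p)) *v v = transpose R *v upper v" for v
    by (rule vector_eq_ldot [THEN iffD1])
      (metis add.right_neutral inner_transpose_mult_vec inner_vstack inner_zero_left
        matrix_vector_mult_0 vstack_mult_vec vstack_upper_lower)
  let ?b = "G *v ?w" and ?c = "transpose R *v ?w"
  have "(norm ?b)\<^sup>2 \<le> (norm ?c)\<^sup>2"
  proof -
    have "0 \<le> ?w \<bullet> ((R ** transpose R - transpose G ** G) *v ?w)"
      using G by (simp add: loewner_le_def pos_semidef_def)
    moreover have "?w \<bullet> (R *v ?c) = ?c \<bullet> ?c"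
      using inner_transpose_mult_vec [of ?w "transpose R"] by simp
    ultimately show ?thesis
      by (simp add: matrix_vector_mult_diff_rdistrib matrix_vector_mul_assoc [symmetric]
          inner_diff_right inner_transpose_mult_vec power2_norm_eq_inner)
  qed
  moreover have "0 \<le> - (2 * (a \<bullet> (Z1 *v (Y1 *v a))) + \<alpha> * (norm a)\<^sup>2
      + 2 * (a \<bullet> (Z1 *v (G2 *v ?b))) - (norm ?b)\<^sup>2 + (norm ?c)\<^sup>2)"
  proof -
    let ?L = "vstack
       (vstack
         (hstack (hstack (Z1 ** Y1 + transpose (Z1 ** Y1) + \<alpha> *\<^sub>R mat 1)
                         (transpose (transpose G2 ** transpose Z1)))
                 (transpose (transpose (vstack R 0) ** P)))
         (hstack (hstack (transpose G2 ** transpose Z1) (- mat 1)) 0))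
       (hstack (hstack (transpose (vstack R 0) ** P) 0) (- mat 1))"
    let ?z = "vstack (vstack a ?b) ?c"
    have "pos_semidef (0 - ?L)"
      using feasible unfolding sdp_feasible_def loewner_le_def by blast
    then have "0 \<le> ?z \<bullet> ((0 - ?L) *v ?z)"
      unfolding pos_semidef_def by blast
    then have "0 \<le> - (?z \<bullet> (?L *v ?z))"
      by (simp only: matrix_vector_mult_diff_rdistrib diff_0 uminus_mult_vec inner_minus_right)
    also have "?z \<bullet> (?L *v ?z) = 2 * (a \<bullet> (Z1 *v (Y1 *v a))) + \<alpha> * (norm a)\<^sup>2
      + 2 * (a \<bullet> (Z1 *v (G2 *v ?b))) - (norm ?b)\<^sup>2 + (norm ?c)\<^sup>2"
    proof -
      have "a \<bullet> (transpose (transpose (vstack R 0) ** P) *v ?c) = ?c \<bullet> ?c"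
        by (simp add: inner_transpose_mult_vec RT matrix_vector_mul_assoc [symmetric])
      moreover have "?b \<bullet> ((transpose G2 ** transpose Z1) *v a) = a \<bullet> (Z1 *v (G2 *v ?b))"
        using inner_transpose_mult_vec [of ?b "Z1 ** G2" a]
        by (simp add: matrix_transpose_mul matrix_vector_mul_assoc [symmetric] inner_commute)
      moreover have "a \<bullet> (transpose (Z1 ** Y1) *v a) = a \<bullet> (Z1 *v (Y1 *v a))"
        by (simp add: inner_transpose_mult_vec matrix_vector_mul_assoc [symmetric] inner_commute)
      moreover have "a \<bullet> (transpose (transpose G2 ** transpose Z1) *v ?b) = a \<bullet> (Z1 *v (G2 *v ?b))"
        by (simp add: matrix_transpose_mul matrix_vector_mul_assoc [symmetric])
      moreover have "?c \<bullet> ((transpose (vstack R 0) ** P) *v a) = ?c \<bullet> ?c"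
        by (simp add: RT matrix_vector_mul_assoc [symmetric])
      ultimately show ?thesis
        by (simp add: uminus_mult_vec inner_add_right inner_diff_right matrix_vector_mult_add_rdistrib power2_norm_eq_inner
            scaleR_matrix_vector_assoc [symmetric] matrix_vector_mul_assoc [symmetric])
    qed
    finally show ?thesis .
  qed
  ultimately show ?thesis
    by (simp only: matrix_vector_right_distrib inner_add_right mult_minus_left distrib_left)
qed

section \<open>Data-based form of the closed loop, and its contraction\<close>

theorem theorem6:
  fixes A :: "real ^ ('n::finite + 'k::finite) ^ 'n"
    and Abar :: "real ^ 'n ^ 'n" and Ahat :: "real ^ 'k ^ 'n"
    and C :: "real ^ ('n + 'k) ^ 'p::finite"
    and Cbar :: "real ^ 'n ^ 'p" and Chat :: "real ^ 'k ^ 'p"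
    and B :: "real ^ 'm::finite ^ 'n"
    and E :: "real ^ 'q::finite ^ 'n"
    and d :: "real ^ 'q" and r :: "real ^ 'p"
    and f :: "real ^ 'n \<Rightarrow> real ^ 'n" and h :: "real ^ 'n \<Rightarrow> real ^ 'p"
    and Z :: "real ^ 'n \<Rightarrow> real ^ ('n + 'k)" and Q :: "real ^ 'n \<Rightarrow> real ^ 'k"
    and ts :: "'t::{finite, linorder} \<Rightarrow> real" and a b :: real and N :: "real set"
    and x xdot :: "real \<Rightarrow> real ^ 'n" and u :: "real \<Rightarrow> real ^ 'm"
    and y e \<xi> :: "real \<Rightarrow> real ^ 'p"
    and U0 :: "real ^ ('t::{finite, linorder}) ^ 'm"
    and Z0 :: "real ^ ('t::{finite, linorder}) ^ (('n + 'p) + 'k)" and Z1 :: "real ^ ('t::{finite, linorder}) ^ ('n + 'p)"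
    and R\<^sub>Q :: "real ^ '\<tau>::finite ^ 'n" and \<X> :: "(real ^ 'n) set"
    and \<R>\<^sub>Q :: "real ^ '\<tau> ^ ('n + 'p)"
    and P :: "real ^ ('n + 'p) ^ ('n + 'p)" and Y1 :: "real ^ ('n + 'p) ^ ('t::{finite, linorder})"
    and G2 :: "real ^ 'k ^ ('t::{finite, linorder})" and \<alpha> :: real
    and K :: "real ^ (('n + 'p) + 'k) ^ 'm"
  assumes f: "\<And>v. f v = A *v Z v" and h: "\<And>v. h v = C *v Z v"
    and Z: "\<And>v. Z v = vstack v (Q v)" "continuously_differentiable Z"
    and Q: "\<And>i. \<not> linear (\<lambda>v. Q v $ i)"
    and A: "A = hstack Abar Ahat" and C: "C = hstack Cbar Chat"
    and traj: "a < b" "ext_trajectory f h B E d r {a..b} N x xdot u y e \<xi>"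
    and times: "strict_mono ts" "range ts \<subseteq> {a..b} - N"
    and U0: "U0 = col_matrix (\<lambda>j. u (ts j))"
    and Z1: "Z1 = col_matrix (\<lambda>j. vstack (xdot (ts j)) (y (ts j)))"
    and Z0: "Z0 = col_matrix (\<lambda>j. vstack (vstack (x (ts j)) (\<xi> (ts j))) (Q (x (ts j))))"
    and R\<^sub>Q: "\<And>v. v \<in> \<X> \<Longrightarrow>
      transpose (jacobian Q (at v)) ** jacobian Q (at v) \<preceq> R\<^sub>Q ** transpose R\<^sub>Q"
    and \<R>\<^sub>Q: "\<R>\<^sub>Q = vstack R\<^sub>Q 0"
    and feasible: "sdp_feasible Z0 Z1 \<R>\<^sub>Q P Y1 G2 \<alpha>"
    and K: "K = U0 ** hstack (Y1 ** matrix_inv P) G2"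
  shows "exp_contractive (closed_loop f h B E d r Q K) (matrix_inv P)
           {vstack v w | v w. v \<in> \<X>} \<and>
    (\<exists>\<beta>>0. \<forall>v\<in>\<X>. \<forall>w.
      transpose ((ext_A Abar Ahat Cbar Chat + ext_B B ** K) **
                 jacobian (ext_Z Q) (at (vstack v w))) ** matrix_inv P +
      matrix_inv P ** ((ext_A Abar Ahat Cbar Chat + ext_B B ** K) **
                 jacobian (ext_Z Q) (at (vstack v w)))
      \<preceq> (- \<beta>) *\<^sub>R matrix_inv P)"
proof -
  define W where "W = hstack (Y1 ** matrix_inv P) G2"
  define Acl where "Acl = ext_A Abar Ahat Cbar Chat + ext_B B ** K"
  \<comment> \<open>The rate comes from \<open>pos_def_inner_matrix_inv_le\<close> and is the same
    at every point; adding 1 makes the denominator positive from nonnegativity of the norm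
    alone.\<close>
  define \<beta> where "\<beta> = \<alpha> / (onorm ((*v) P) + 1)"
  have P: "pos_def P" and \<alpha>: "\<alpha> > 0" and Z0Y1: "Z0 ** Y1 = vstack P 0"
    and Z0G2: "Z0 ** G2 = vstack 0 (mat 1)" and ones: "ones_row ** hstack Y1 G2 = 0"
    using feasible by (simp_all add: sdp_feasible_def)
  note inv = matrix_inv_mult_vec [OF pos_def_invertible [OF P]]
  note Pi = pos_def_matrix_inv [OF P]
  have onorm0: "0 \<le> onorm ((*v) P)"
    by (rule onorm_pos_le) (rule matrix_vector_mul_bounded_linear)
  have \<beta>0: "\<beta> > 0" using onorm0 \<alpha> by (simp add: \<beta>_def)

  \<comment> \<open>Moving the inverse from the matrix to the argument exposes \<open>Y1\<close> and
    \<open>G2\<close>, for which the constraints are stated.\<close>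
  have W: "W *v q = hstack Y1 G2 *v vstack (matrix_inv P *v upper q) (lower q)" for q
    by (simp add: W_def matrix_vector_mul_assoc [symmetric])
  have Z0W: "Z0 *v (W *v q) = q" for q
  proof -
    have "Z0 *v (W *v q) = (Z0 ** Y1) *v (matrix_inv P *v upper q) + (Z0 ** G2) *v lower q"
      by (simp add: W matrix_vector_right_distrib matrix_vector_mul_assoc [symmetric])
    then show ?thesis by (simp add: Z0Y1 Z0G2 inv vstack_decompose [symmetric])
  qed
  \<comment> \<open>This sum is the coefficient with which the constant disturbance enters
    \<open>Z1 *v (W *v q)\<close>, so \<open>d\<close> drops out without being known.\<close>
  have sumW: "(\<Sum>j\<in>UNIV. (W *v q) $ j) = 0" for q
  proof -
    have "ones_row *v (W *v q) = (0 :: real ^ 1)"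
      unfolding W matrix_vector_mul_assoc ones by simp
    then show ?thesis by (simp add: ones_row_def matrix_vector_mult_def vec_eq_iff)
  qed
  \<comment> \<open>The sampling times avoid \<open>N\<close>, so the differential equation holds at
    each of them. The lower block records \<open>y\<close> and not \<open>e\<close>, so
    \<open>r\<close> does not enter.\<close>
  have Z1eq: "Z1 = col_matrix (\<lambda>j.
      ext_A Abar Ahat Cbar Chat *v (vstack (vstack (x (ts j)) (\<xi> (ts j))) (Q (x (ts j))))
      + ext_B B *v u (ts j) + vstack (E *v d) 0)"
  proof -
    have "vstack (xdot (ts j)) (y (ts j)) =
      ext_A Abar Ahat Cbar Chat *v (vstack (vstack (x (ts j)) (\<xi> (ts j))) (Q (x (ts j))))
      + ext_B B *v u (ts j) + vstack (E *v d) 0" for j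
    proof -
      have "ts j \<in> {a..b} - N" using times(2) by blast
      then have "xdot (ts j) = f (x (ts j)) + B *v u (ts j) + E *v d" "y (ts j) = h (x (ts j))"
        using traj(2) by (simp_all add: ext_trajectory_def)
      then show ?thesis
        by (simp add: f h Z(1) A C ext_A_def ext_B_def vstack_eq_iff)
    qed
    then show ?thesis by (simp only: Z1)
  qed
  have Acl: "Acl *v q = Z1 *v (W *v q)" for q
  proof -
    have "Z1 *v (W *v q) = (ext_A Abar Ahat Cbar Chat ** Z0) *v (W *v q) + (ext_B B ** U0) *v (W *v q)
        + (\<Sum>j\<in>UNIV. (W *v q) $ j) *\<^sub>R vstack (E *v d) 0"
      unfolding Z1eq Z0 U0 matrix_mult_col_matrix col_matrix_mult_vec
      by (simp add: scaleR_add_right sum.distrib scaleR_left.sum)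
    also have "\<dots> = Acl *v q"
      by (simp add: sumW Acl_def K W_def [symmetric] matrix_vector_mult_add_rdistrib Z0W
          matrix_vector_mul_assoc [symmetric])
    finally show ?thesis ..
  qed

  \<comment> \<open>\<open>Q\<close> inherits differentiability as the lower block of
    \<open>Z\<close>.\<close>
  have diffQ: "Q differentiable (at v)" for v
  proof -
    have "Z differentiable (at v)" using Z(2) by (simp add: continuously_differentiable_def)
    then obtain D where "(Z has_derivative D) (at v)" by (auto simp: differentiable_def)
    from bounded_linear.has_derivative [OF bounded_linear_lower this] show ?thesis
      unfolding differentiable_def by (auto simp: Z(1))
  qed
  note dZ = ext_Z_has_derivative [OF diffQ]
  \<comment> \<open>\<open>d\<close> and \<open>r\<close> enter only through a constant offset,
    which differentiation removes.\<close>
  have cl: "closed_loop f h B E d r Q K = (\<lambda>z. Acl *v ext_Z Q z + vstack (E *v d) (- r))"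
    by (rule ext)
      (simp add: closed_loop_def Acl_def f h Z(1) A C ext_A_def ext_B_def ext_Z_eq vstack_eq_iff
        matrix_vector_mult_add_rdistrib matrix_vector_mul_assoc [symmetric])
  have dcl: "(closed_loop f h B E d r Q K has_derivative (*v) (Acl ** jacobian (ext_Z Q) (at z))) (at z)" for z
    unfolding cl jacobian_eqI [OF dZ] matrix_vector_mul_assoc [symmetric, abs_def]
    using has_derivative_add_const [OF bounded_linear.has_derivative [OF matrix_vector_mul_bounded_linear dZ]]
    by (simp add: matrix_vector_mul_assoc [symmetric])

  have main: "transpose (Acl ** jacobian (ext_Z Q) (at (vstack v w))) ** matrix_inv P
      + matrix_inv P ** (Acl ** jacobian (ext_Z Q) (at (vstack v w))) \<preceq> (- \<beta>) *\<^sub>R matrix_inv P"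
    if "v \<in> \<X>" for v w
  proof (rule contraction_from_quadratic_form)
    show "transpose (matrix_inv P) = matrix_inv P" using Pi by (simp add: pos_def_def)
    fix q
    let ?a = "matrix_inv P *v q"
    \<comment> \<open>Since \<open>P *v ?a = q\<close>, the vector in the quadratic estimate is
      exactly the closed-loop Jacobian applied to \<open>q\<close>.\<close>
    have "2 * (?a \<bullet> ((Acl ** jacobian (ext_Z Q) (at (vstack v w))) *v q)) \<le> - \<alpha> * (norm ?a)\<^sup>2"
      using sdp_feasible_quadratic_form [OF feasible [unfolded \<R>\<^sub>Q] R\<^sub>Q [OF that], of ?a]
      by (simp add: jacobian_eqI [OF dZ] matrix_vector_mul_assoc [symmetric] Acl W inv)
    moreover have "\<beta> * (q \<bullet> ?a) \<le> \<alpha> * (norm ?a)\<^sup>2"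
    proof -
      have "\<beta> * (q \<bullet> ?a) \<le> \<beta> * (onorm ((*v) P) * (norm ?a)\<^sup>2)"
        using pos_def_inner_matrix_inv_le [OF P] \<beta>0 by (intro mult_left_mono) auto
      also have "\<dots> \<le> \<beta> * ((onorm ((*v) P) + 1) * (norm ?a)\<^sup>2)"
        using \<beta>0 by (intro mult_left_mono mult_right_mono) auto
      also have "\<dots> = \<alpha> * (norm ?a)\<^sup>2"
        using onorm0 by (simp add: \<beta>_def)
      finally show ?thesis .
    qed
    ultimately show "2 * (?a \<bullet> ((Acl ** jacobian (ext_Z Q) (at (vstack v w))) *v q)) \<le> - \<beta> * (q \<bullet> ?a)"
      by simp
  qed
  \<comment> \<open>By \<open>dcl\<close> the Jacobian of the vector field is the matrix product in
    the second conjunct, so \<open>main\<close> proves both with the same rate.\<close>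
  show ?thesis
    unfolding exp_contractive_def Acl_def [symmetric] jacobian_eqI [OF dcl]
    using main \<beta>0 Pi dcl by (auto simp: differentiable_def)
qed

end
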